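(* Let $A=\mathbb{R}[x,y]$ where $x^2+y^2-1=0$ (the coordinate ring of the algebraic circle $\mathbb{S}^1$), and let $B=\mathbb{C}\otimes_{\mathbb{R}}A=\mathbb{C}[t,t^{-1}]$, where $t=x+iy$. Let $V=\{z\in\mathbb{C} : \|z\|=1\}$ and $U=\{z\in\mathbb{C} : 0<\|z\|<1\}$, and define subgroups of $\Pi(A)$ by $$G=\langle [t-z] : z\in V\rangle,\qquad H=\langle [t-z] : z\in U\rangle .$$ Then: (i) $\gamma^2=1$ for every $\gamma\in G$, and $G$ is generated by the classes $[t-e^{i\theta}]$ with $0\le\theta<\pi/2$; (ii) $H$ is a free abelian group with basis indexed by $U$, namely the classes $[t-z]$, $z\in U$; (iii) $\Pi(A)$ is the internal direct product $G\times H$.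
   Context: For a ring $R$, $R^*$ denotes its unit group. With $K=\mathrm{frac}(A)$ and $L=\mathrm{frac}(B)=K[i]$, the polar group of $A$ is $\Pi(A)=L^*/B^*K^*$, and $[f]$ denotes the class in $\Pi(A)$ of a nonzero $f\in B$. $\|a+bi\|=\sqrt{a^2+b^2}$ for $a,b\in\mathbb{R}$. *)

theory Defs
  imports
    Complex_Main
    "HOL-Computational_Algebra.Polynomial"
    "HOL-Computational_Algebra.Polynomial_Factorial"
    "HOL-Algebra.Free_Abelian_Groups"
begin

section \<open>Complexification\<close>

text \<open>For a commutative ring \<open>A\<close>, the type \<open>'a cplx\<close> is \<open>A[i] = A \<oplus> A i\<close> with \<open>i\<^sup>2 = -1\<close>.
  If \<open>A\<close> is an \<open>\<real>\<close>-algebra, this is \<open>\<complex> \<otimes> A\<close> (tensor product over \<open>\<real>\<close>).\<close>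

datatype 'a cplx = Cx (cx_re: 'a) (cx_im: 'a)

lemma cplx_eq_iff: "z = w \<longleftrightarrow> cx_re z = cx_re w \<and> cx_im z = cx_im w"
  by (cases z; cases w) simp

instantiation cplx :: (comm_ring_1) comm_ring_1
begin

definition "0 = Cx 0 0"
definition "1 = Cx 1 0"
definition "z + w = Cx (cx_re z + cx_re w) (cx_im z + cx_im w)"
definition "- z = Cx (- cx_re z) (- cx_im z)"
definition "z - w = Cx (cx_re z - cx_re w) (cx_im z - cx_im w)"
definition "z * w = Cx (cx_re z * cx_re w - cx_im z * cx_im w)
                       (cx_re z * cx_im w + cx_im z * cx_re w)"

instance
  by standard
    (simp_all add: zero_cplx_def one_cplx_def plus_cplx_def uminus_cplx_def minus_cplx_def
      times_cplx_def cplx_eq_iff algebra_simps)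

end

lemma cplx_sel [simp]:
  "cx_re 0 = (0::'a::comm_ring_1)" "cx_im 0 = (0::'a)"
  "cx_re 1 = (1::'a)" "cx_im 1 = (0::'a)"
  "cx_re (z + w) = cx_re z + (cx_re w :: 'a)" "cx_im (z + w) = cx_im z + (cx_im w :: 'a)"
  "cx_re (- z) = - (cx_re z :: 'a)" "cx_im (- z) = - (cx_im z :: 'a)"
  "cx_re (z - w) = cx_re z - (cx_re w :: 'a)" "cx_im (z - w) = cx_im z - (cx_im w :: 'a)"
  "cx_re (z * w) = cx_re z * cx_re w - cx_im z * (cx_im w :: 'a)"
  "cx_im (z * w) = cx_re z * cx_im w + cx_im z * (cx_re w :: 'a)"
  by (simp_all add: zero_cplx_def one_cplx_def plus_cplx_def uminus_cplx_def minus_cplx_def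
      times_cplx_def)

text \<open>The integral domains \<open>A\<close> for which \<open>A[i]\<close> is an integral domain.\<close>

class polar_idom = idom +
  assumes sum_squares_zero: "a * a + b * b = 0 \<Longrightarrow> a = 0"

instance cplx :: (polar_idom) idom
proof
  fix z w :: "'a cplx"
  assume nz: "z \<noteq> 0" "w \<noteq> 0"
  define N where "N = (\<lambda>u :: 'a cplx. cx_re u * cx_re u + cx_im u * cx_im u)"
  have N0: "u = 0" if "N u = 0" for u
  proof -
    have "cx_re u = 0"
      using that sum_squares_zero unfolding N_def by blast
    moreover have "cx_im u = 0"
      using that sum_squares_zero[of "cx_im u" "cx_re u"] unfolding N_def by (simp add: add.commute)
    ultimately show ?thesis by (simp add: cplx_eq_iff)
  qed
  have "N (z * w) = N z * N w"
    by (simp add: N_def algebra_simps)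
  with nz N0 have "N (z * w) \<noteq> 0" by auto
  moreover have "N 0 = 0" by (simp add: N_def)
  ultimately show "z * w \<noteq> 0" by metis
qed

section \<open>The polar group\<close>

text \<open>With \<open>B = A[i]\<close> of type \<open>'a cplx\<close>, its fraction field \<open>L\<close> is the type \<open>'a cplx fract\<close>, and
  \<open>mult_group\<close> at this type is \<open>L\<^sup>*\<close>.  The polar group is the quotient of \<open>L\<^sup>*\<close> by
  \<open>B\<^sup>*K\<^sup>*\<close>.\<close>

definition mult_group :: "('k::field) monoid" where
  "mult_group = \<lparr>carrier = UNIV - {0}, monoid.mult = (*), one = 1\<rparr>"

text \<open>\<open>B\<^sup>*\<close> inside \<open>L\<^sup>*\<close>.\<close>

definition units_in_L :: "('a::polar_idom) cplx fract set" where
  "units_in_L = {to_fract b | b. b dvd 1}"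

text \<open>\<open>K = frac(A)\<close> inside \<open>L\<close>.\<close>

definition K_in_L :: "('a::polar_idom) cplx fract set" where
  "K_in_L = {Fract (Cx a 0) (Cx b 0) | a b. b \<noteq> 0}"

definition polar_kernel :: "('a::polar_idom) cplx fract set" where
  "polar_kernel = units_in_L <#>\<^bsub>mult_group\<^esub> (K_in_L - {0})"

definition polar_group :: "'a itself \<Rightarrow> ('a::polar_idom) cplx fract set monoid" where
  "polar_group _ = mult_group Mod polar_kernel"

definition polar_class :: "('a::polar_idom) cplx \<Rightarrow> 'a cplx fract set" where
  "polar_class f = polar_kernel #>\<^bsub>mult_group\<^esub> to_fract f"

lemma comm_group_mult_group: "comm_group (mult_group :: ('k::field) monoid)"
proof (rule comm_groupI)
  fix x :: 'k assume "x \<in> carrier mult_group"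
  then show "\<exists>y\<in>carrier mult_group. y \<otimes>\<^bsub>mult_group\<^esub> x = \<one>\<^bsub>mult_group\<^esub>"
    by (intro bexI[of _ "inverse x"]) (auto simp: mult_group_def)
qed (auto simp: mult_group_def)

lemma inv_mult_group: "x \<noteq> 0 \<Longrightarrow> inv\<^bsub>mult_group\<^esub> x = inverse (x::'k::field)"
  by (rule group.inv_equality[OF comm_group.axioms(2)[OF comm_group_mult_group]])
    (auto simp: mult_group_def)

lemma subgroup_units_in_L: "subgroup (units_in_L :: 'a::polar_idom cplx fract set) mult_group"
proof (rule group.subgroupI[OF comm_group.axioms(2)[OF comm_group_mult_group]])
  have nz: "x \<noteq> 0" if "x \<in> units_in_L" for x :: "'a cplx fract"
    using that by (auto simp: units_in_L_def)
  then show "(units_in_L :: 'a cplx fract set) \<subseteq> carrier mult_group"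
    by (auto simp: mult_group_def)
  show "(units_in_L :: 'a cplx fract set) \<noteq> {}"
    using dvd_refl[of "1 :: 'a cplx"] unfolding units_in_L_def by blast
  fix x y :: "'a cplx fract"
  assume x: "x \<in> units_in_L"
  then obtain b c where bc: "x = to_fract b" "1 = b * c" by (auto simp: units_in_L_def elim: dvdE)
  then have "x * to_fract c = 1"
    by (metis to_fract_1 to_fract_mult)
  then have "inverse x = to_fract c" by (rule inverse_unique)
  moreover have "c dvd 1" using bc(2) by (metis dvd_triv_right)
  ultimately show "inv\<^bsub>mult_group\<^esub> x \<in> units_in_L"
    using nz[OF x] by (auto simp: inv_mult_group units_in_L_def)
  assume "y \<in> units_in_L"
  then obtain d where d: "y = to_fract d" "d dvd 1" by (auto simp: units_in_L_def)
  have "b dvd 1" using bc(2) by (metis dvd_triv_left)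
  from mult_dvd_mono[OF this d(2)] have "b * d dvd 1" by simp
  moreover have "x * y = to_fract (b * d)" by (simp add: bc d)
  ultimately have "x * y \<in> units_in_L" unfolding units_in_L_def by blast
  then show "x \<otimes>\<^bsub>mult_group\<^esub> y \<in> units_in_L" by (simp add: mult_group_def)
qed

lemma subgroup_K_in_L: "subgroup (K_in_L - {0} :: 'a::polar_idom cplx fract set) mult_group"
proof (rule group.subgroupI[OF comm_group.axioms(2)[OF comm_group_mult_group]])
  have Cx0: "Cx b 0 = 0 \<longleftrightarrow> b = 0" for b :: 'a by (simp add: zero_cplx_def)
  have Cxm: "Cx a 0 * Cx b 0 = Cx (a * b) 0" for a b :: 'a by (simp add: cplx_eq_iff)
  show "(K_in_L - {0} :: 'a cplx fract set) \<subseteq> carrier mult_group"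
    by (auto simp: mult_group_def)
  have "1 \<in> (K_in_L :: 'a cplx fract set)"
    unfolding K_in_L_def One_fract_def one_cplx_def by force
  then show "(K_in_L - {0} :: 'a cplx fract set) \<noteq> {}"
    by auto
  fix x y :: "'a cplx fract"
  assume x: "x \<in> K_in_L - {0}"
  then obtain a b where ab: "x = Fract (Cx a 0) (Cx b 0)" "b \<noteq> 0" by (auto simp: K_in_L_def)
  with x have "a \<noteq> 0" by (auto simp: Cx0 rat_number_collapse fract_collapse zero_cplx_def[symmetric])
  moreover have "inverse x = Fract (Cx b 0) (Cx a 0)" by (simp add: ab)
  ultimately have "inverse x \<in> K_in_L" unfolding K_in_L_def by blast
  then show "inv\<^bsub>mult_group\<^esub> x \<in> K_in_L - {0}"
    using x by (simp add: inv_mult_group)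
  assume y: "y \<in> K_in_L - {0}"
  then obtain c d where cd: "y = Fract (Cx c 0) (Cx d 0)" "d \<noteq> 0" by (auto simp: K_in_L_def)
  have "x * y = Fract (Cx (a * c) 0) (Cx (b * d) 0)" by (simp add: ab cd Cxm)
  moreover have "b * d \<noteq> 0" using ab cd by simp
  ultimately have "x * y \<in> K_in_L" unfolding K_in_L_def by blast
  then show "x \<otimes>\<^bsub>mult_group\<^esub> y \<in> K_in_L - {0}"
    using x y by (simp add: mult_group_def)
qed

lemma subgroup_polar_kernel: "subgroup (polar_kernel :: 'a::polar_idom cplx fract set) mult_group"
  unfolding polar_kernel_def
  by (rule comm_group.mult_subgroups[OF comm_group_mult_group subgroup_units_in_L subgroup_K_in_L])

lemma comm_group_polar_group: "comm_group (polar_group TYPE('a::polar_idom))"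
  unfolding polar_group_def
  by (rule comm_group.abelian_FactGroup[OF comm_group_mult_group subgroup_polar_kernel])

lemma polar_class_in_carrier:
  "f \<noteq> 0 \<Longrightarrow> polar_class (f :: 'a::polar_idom cplx) \<in> carrier (polar_group TYPE('a))"
  by (auto simp: polar_group_def polar_class_def FactGroup_def RCOSETS_def mult_group_def)

text \<open>\<open>L = K[i]\<close>.\<close>

lemma L_eq_K_adjoin_i: "\<exists>u\<in>K_in_L. \<exists>v\<in>K_in_L. f = u + v * to_fract (Cx 0 (1::'a::polar_idom))"
proof -
  obtain p q :: "'a cplx" where pq: "f = Fract p q" "q \<noteq> 0" by (cases f)
  define n where "n = cx_re q * cx_re q + cx_im q * cx_im q"
  define q' where "q' = Cx (cx_re q) (- cx_im q)"
  have qq: "q * q' = Cx n 0" by (simp add: cplx_eq_iff n_def q'_def)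
  have "q' \<noteq> 0" using pq by (auto simp: q'_def cplx_eq_iff)
  with pq qq have n: "Cx n 0 \<noteq> 0" by (metis no_zero_divisors)
  then have n0: "n \<noteq> 0" by (auto simp: zero_cplx_def)
  define a b where "a = cx_re (p * q')" and "b = cx_im (p * q')"
  have pq': "p * q' = Cx a 0 + Cx b 0 * Cx 0 1" by (simp add: a_def b_def cplx_eq_iff)
  have "f = Fract (p * q') (q * q')"
    using pq \<open>q' \<noteq> 0\<close> by (simp add: eq_fract mult_ac)
  then have "f = Fract (p * q') (Cx n 0)" by (simp only: qq)
  also have "\<dots> = Fract (Cx a 0) (Cx n 0) + Fract (Cx b 0) (Cx n 0) * to_fract (Cx 0 1)"
    using n by (simp add: pq' to_fract_def eq_fract algebra_simps)
  finally show ?thesis using n0 unfolding K_in_L_def by blast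
qed

definition internal_direct_product :: "('a, 'b) monoid_scheme \<Rightarrow> 'a set \<Rightarrow> 'a set \<Rightarrow> bool" where
  "internal_direct_product P G H \<longleftrightarrow>
     G \<lhd> P \<and> H \<lhd> P \<and> G \<inter> H = {\<one>\<^bsub>P\<^esub>} \<and> G <#>\<^bsub>P\<^esub> H = carrier P"

section \<open>The coordinate ring of the circle\<close>

text \<open>\<open>\<real>[X,Y]\<close> is \<open>\<real>[X][Y]\<close>; the polynomial below is \<open>X\<^sup>2 + Y\<^sup>2 - 1\<close>.\<close>

definition circle_poly :: "real poly poly" where
  "circle_poly = [:[:-1, 0, 1:], 0, 1:]"

definition circle_rel :: "real poly poly \<Rightarrow> real poly poly \<Rightarrow> bool" where
  "circle_rel p q \<longleftrightarrow> circle_poly dvd p - q"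

quotient_type circle_ring = "real poly poly" / circle_rel
proof (rule equivpI)
  show "reflp circle_rel" by (auto simp: reflp_def circle_rel_def)
  show "symp circle_rel" 
    unfolding symp_def circle_rel_def by (metis dvd_minus_iff minus_diff_eq)
  show "transp circle_rel"
    unfolding transp_def circle_rel_def
  proof (intro allI impI)
    fix p q r assume "circle_poly dvd p - q" "circle_poly dvd q - r"
    then have "circle_poly dvd (p - q) + (q - r)" by (rule dvd_add)
    then show "circle_poly dvd p - r" by simp
  qed
qed

instantiation circle_ring :: comm_ring_1
begin

lift_definition zero_circle_ring :: circle_ring is 0 .
lift_definition one_circle_ring :: circle_ring is 1 .
lift_definition plus_circle_ring :: "circle_ring \<Rightarrow> circle_ring \<Rightarrow> circle_ring" is "(+)"
proof -
  fix p p' q q' assume "circle_rel p p'" "circle_rel q q'"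
  then have "circle_poly dvd (p - p') + (q - q')" unfolding circle_rel_def by (rule dvd_add)
  then show "circle_rel (p + q) (p' + q')" unfolding circle_rel_def by (simp add: algebra_simps)
qed
lift_definition uminus_circle_ring :: "circle_ring \<Rightarrow> circle_ring" is uminus
proof -
  fix p p' assume "circle_rel p p'"
  then have "circle_poly dvd - (p - p')" unfolding circle_rel_def by (simp only: dvd_minus_iff)
  then show "circle_rel (- p) (- p')" unfolding circle_rel_def by simp
qed
lift_definition minus_circle_ring :: "circle_ring \<Rightarrow> circle_ring \<Rightarrow> circle_ring" is "(-)"
proof -
  fix p p' q q' assume "circle_rel p p'" "circle_rel q q'"
  then have "circle_poly dvd (p - p') - (q - q')" unfolding circle_rel_def by (rule dvd_diff)
  then show "circle_rel (p - q) (p' - q')" unfolding circle_rel_def by (simp add: algebra_simps)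
qed
lift_definition times_circle_ring :: "circle_ring \<Rightarrow> circle_ring \<Rightarrow> circle_ring" is "(*)"
proof -
  fix p p' q q' assume "circle_rel p p'" "circle_rel q q'"
  then have "circle_poly dvd (p - p') * q + p' * (q - q')" unfolding circle_rel_def by simp
  then show "circle_rel (p * q) (p' * q')" unfolding circle_rel_def by (simp add: algebra_simps)
qed

lemma circle_rel_refl [simp]: "circle_rel p p"
  by (simp add: circle_rel_def)

instance
proof
  show "(0::circle_ring) \<noteq> 1"
  proof transfer
    have "\<not> circle_poly dvd 1"
    proof
      assume "circle_poly dvd 1"
      then have "degree circle_poly \<le> degree (1 :: real poly poly)"
        by (rule dvd_imp_degree_le) simp
      then show False by (simp add: circle_poly_def)
    qed
    then show "\<not> circle_rel 0 1" by (simp add: circle_rel_def)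
  qed
qed (transfer; simp add: algebra_simps)+

end

text \<open>The value of a function on the circle at the real point \<open>(cos \<theta>, sin \<theta>)\<close>.\<close>

lift_definition circle_eval :: "circle_ring \<Rightarrow> real \<Rightarrow> real" is
  "\<lambda>p \<theta>. poly (poly p [:sin \<theta>:]) (cos \<theta>)"
proof
  fix p q :: "real poly poly" and \<theta> :: real
  assume "circle_rel p q"
  then obtain r where r: "p = q + circle_poly * r" unfolding circle_rel_def
    by (metis add.commute diff_add_cancel dvdE)
  have "poly (poly circle_poly [:sin \<theta>:]) (cos \<theta>) = 0"
    using sin_cos_squared_add[of \<theta>] by (simp add: circle_poly_def power2_eq_square)
  then show "poly (poly p [:sin \<theta>:]) (cos \<theta>) = poly (poly q [:sin \<theta>:]) (cos \<theta>)"
    by (simp add: r)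
qed

lemma circle_eval_simps [simp]:
  "circle_eval 0 \<theta> = 0" "circle_eval 1 \<theta> = 1"
  "circle_eval (a + b) \<theta> = circle_eval a \<theta> + circle_eval b \<theta>"
  "circle_eval (a - b) \<theta> = circle_eval a \<theta> - circle_eval b \<theta>"
  "circle_eval (- a) \<theta> = - circle_eval a \<theta>"
  "circle_eval (a * b) \<theta> = circle_eval a \<theta> * circle_eval b \<theta>"
  by (transfer; simp)+

lemma inj_on_cos_0_pi: "inj_on cos {0..pi}"
  by (auto intro!: inj_onI cos_inj_pi)

lemma circle_poly_division: "\<exists>q a b. p = q * circle_poly + [:a, b:]"
proof (induction p)
  case 0
  then show ?case by (intro exI[of _ 0]) simp
next
  case (pCons c p)
  then obtain q a b where p: "p = q * circle_poly + [:a, b:]" by blast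
  have "pCons c p = [:c:] + [:0, 1:] * p" by simp
  also have "\<dots> = ([:0, 1:] * q + [:b:]) * circle_poly + [:c - b * [:-1, 0, 1:], a:]"
    unfolding p by (simp add: algebra_simps circle_poly_def)
  finally show ?case by blast
qed

lemma circle_eval_infinite_zero:
  assumes "infinite {\<theta>\<in>{0..pi}. circle_eval f \<theta> = 0}"
  shows "f = 0"
  using assms
proof transfer
  fix p :: "real poly poly"
  define S where "S = {\<theta>\<in>{0..pi}. poly (poly p [:sin \<theta>:]) (cos \<theta>) = 0}"
  assume "infinite {\<theta>\<in>{0..pi}. poly (poly p [:sin \<theta>:]) (cos \<theta>) = 0}"
  then have "infinite S" by (simp only: S_def not_False_eq_True)
  moreover have "inj_on cos S"
    by (rule inj_on_subset[OF inj_on_cos_0_pi]) (auto simp: S_def)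
  ultimately have inf: "infinite (cos ` S)" by (simp add: finite_image_iff)
  obtain q a b where p: "p = q * circle_poly + [:a, b:]" using circle_poly_division by blast
  define N where "N = a\<^sup>2 - b\<^sup>2 * [:1, 0, -1:]"
  have "poly N u = 0" if u: "u \<in> cos ` S" for u
  proof -
    obtain \<theta> where \<theta>: "u = cos \<theta>" "poly (poly p [:sin \<theta>:]) u = 0" using u unfolding S_def by blast
    have "poly (poly circle_poly [:sin \<theta>:]) u = 0"
      using sin_cos_squared_add[of \<theta>] by (simp add: circle_poly_def power2_eq_square \<theta>)
    with \<theta> have "poly a u = - (sin \<theta> * poly b u)" by (simp add: p)
    then show ?thesis
      by (simp add: N_def power_mult_distrib sin_squared_eq \<theta>) (simp add: algebra_simps power2_eq_square)
  qed
  then have "cos ` S \<subseteq> {u. poly N u = 0}" by auto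
  with inf have N: "N = 0" using poly_roots_finite[of N] finite_subset by blast
  have ab: "poly a u = 0 \<and> poly b u = 0" if "u > 1" for u
  proof -
    have "(poly a u)\<^sup>2 + (poly b u)\<^sup>2 * (u\<^sup>2 - 1) = poly N u"
      by (simp add: N_def algebra_simps power2_eq_square)
    then have "(poly a u)\<^sup>2 + (poly b u)\<^sup>2 * (u\<^sup>2 - 1) = 0" by (simp add: N)
    moreover have "u\<^sup>2 - 1 > 0" using that by (simp add: one_less_power)
    ultimately show ?thesis
      by (smt (verit) mult_eq_0_iff mult_nonneg_nonneg power_eq_0_iff zero_le_power2)
  qed
  have zero: "c = 0" if "\<And>u. u > 1 \<Longrightarrow> poly c u = 0" for c :: "real poly"
  proof (rule ccontr)
    assume "c \<noteq> 0"
    then have "finite {1<..(2::real)}"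
      using poly_roots_finite[of c] that by (rule_tac finite_subset) auto
    then show False using infinite_Ioc[of 1 "2 :: real"] by simp
  qed
  from ab have "a = 0" "b = 0" by (auto intro: zero)
  then show "circle_rel p 0" by (simp add: p circle_rel_def)
qed

instance circle_ring :: polar_idom
proof
  fix a b :: circle_ring
  have inf: "infinite {0..pi}" by simp
  {
    assume nz: "a \<noteq> 0" "b \<noteq> 0"
    show "a * b \<noteq> 0"
    proof
      assume "a * b = 0"
      then have "circle_eval a \<theta> * circle_eval b \<theta> = 0" for \<theta>
        by (metis circle_eval_simps(1,6))
      then have "{0..pi} = {\<theta>\<in>{0..pi}. circle_eval a \<theta> = 0} \<union> {\<theta>\<in>{0..pi}. circle_eval b \<theta> = 0}"
        by auto
      then show False
        using inf nz circle_eval_infinite_zero by (metis infinite_Un)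
    qed
  next
    assume "a * a + b * b = 0"
    then have "circle_eval a \<theta> * circle_eval a \<theta> + circle_eval b \<theta> * circle_eval b \<theta> = 0" for \<theta>
      by (metis circle_eval_simps(1,3,6))
    then have "circle_eval a \<theta> = 0" for \<theta> by (simp add: sum_squares_eq_zero_iff)
    then have "{0..pi} = {\<theta>\<in>{0..pi}. circle_eval a \<theta> = 0}" by auto
    then show "a = 0" using inf circle_eval_infinite_zero by metis
  }
qed

lift_definition circle_x :: circle_ring is "[:[:0, 1:]:]" .
lift_definition circle_y :: circle_ring is "[:0, 1:]" .
lift_definition circle_const :: "real \<Rightarrow> circle_ring" is "\<lambda>c. [:[:c:]:]" .

lemma circle_xy: "circle_x\<^sup>2 + circle_y\<^sup>2 - 1 = 0"
  unfolding power2_eq_square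
  by transfer (simp add: circle_rel_def circle_poly_def one_pCons)

lemma circle_eval_gens [simp]:
  "circle_eval circle_x \<theta> = cos \<theta>" "circle_eval circle_y \<theta> = sin \<theta>"
  "circle_eval (circle_const c) \<theta> = c"
  by (transfer; simp)+

text \<open>The embedding of \<open>\<complex>\<close> in \<open>B\<close>, and \<open>t = x + i y\<close>.\<close>

definition circle_cconst :: "complex \<Rightarrow> circle_ring cplx" where
  "circle_cconst z = Cx (circle_const (Re z)) (circle_const (Im z))"

definition circle_t :: "circle_ring cplx" where
  "circle_t = Cx circle_x circle_y"

text \<open>\<open>B = \<complex>[t, t\<^sup>-\<^sup>1]\<close>: the element \<open>t\<close> is invertible and transcendental over \<open>\<complex>\<close>, and
  \<open>\<complex>\<close>, \<open>t\<close> and the inverse of \<open>t\<close> generate \<open>B\<close>.\<close>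

lemma circle_const_simps [simp]:
  "circle_const 0 = 0" "circle_const 1 = 1"
  "circle_const (a + b) = circle_const a + circle_const b"
  "circle_const (a - b) = circle_const a - circle_const b"
  "circle_const (- a) = - circle_const a"
  "circle_const (a * b) = circle_const a * circle_const b"
  by (transfer; simp add: one_pCons)+

lemma circle_cconst_simps [simp]:
  "circle_cconst 0 = 0" "circle_cconst 1 = 1"
  "circle_cconst (a + b) = circle_cconst a + circle_cconst b"
  "circle_cconst (a - b) = circle_cconst a - circle_cconst b"
  "circle_cconst (- a) = - circle_cconst a"
  "circle_cconst (a * b) = circle_cconst a * circle_cconst b"
  by (simp_all add: circle_cconst_def cplx_eq_iff algebra_simps)

lemma circle_t_inverse: "circle_t * Cx circle_x (- circle_y) = 1"
  using circle_xy by (simp add: circle_t_def cplx_eq_iff power2_eq_square algebra_simps)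

definition circle_t_poly :: "complex poly \<Rightarrow> circle_ring cplx" where
  "circle_t_poly p = poly (map_poly circle_cconst p) circle_t"

lemma circle_t_poly_pCons [simp]:
  "circle_t_poly 0 = 0"
  "circle_t_poly (pCons c p) = circle_cconst c + circle_t * circle_t_poly p"
  by (simp_all add: circle_t_poly_def map_poly_pCons)

lemma circle_t_poly_add [simp]: "circle_t_poly (p + q) = circle_t_poly p + circle_t_poly q"
  by (induction p q rule: poly_induct2) (simp_all add: algebra_simps)

lemma circle_t_poly_smult [simp]: "circle_t_poly (smult c p) = circle_cconst c * circle_t_poly p"
  by (induction p) (simp_all add: algebra_simps)

lemma circle_t_poly_mult [simp]: "circle_t_poly (p * q) = circle_t_poly p * circle_t_poly q"
  by (induction p) (simp_all add: algebra_simps)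

lemma circle_t_poly_power: "circle_t ^ n = circle_t_poly ([:0, 1:] ^ n)"
proof (induction n)
  case 0
  have "circle_t_poly [:1:] = 1" by (simp del: one_poly_eq_simps)
  then show ?case by (simp add: one_pCons)
qed simp

lemma circle_t_poly_inject:
  assumes "circle_t_poly p = 0"
  shows "p = 0"
proof (rule ccontr)
  assume "p \<noteq> 0"
  define ev where "ev = (\<lambda>(b :: circle_ring cplx) \<theta>.
    Complex (circle_eval (cx_re b) \<theta>) (circle_eval (cx_im b) \<theta>))"
  have "ev (circle_t_poly q) \<theta> = poly q (cis \<theta>)" for q \<theta>
    by (induction q)
      (simp_all add: ev_def complex_eq_iff circle_cconst_def circle_t_def algebra_simps)
  moreover have "ev 0 \<theta> = 0" for \<theta> by (simp add: ev_def complex_eq_iff)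
  ultimately have "poly p (cis \<theta>) = 0" for \<theta> using assms by metis
  then have "cos ` {0..pi} \<subseteq> Re ` {z. poly p z = 0}"
    by (auto intro!: image_eqI[of _ _ "cis _"])
  then have "finite (cos ` {0..pi})"
    using poly_roots_finite[OF \<open>p \<noteq> 0\<close>] finite_subset by blast
  then show False
    using finite_image_iff[OF inj_on_cos_0_pi] infinite_Icc[OF pi_gt_zero] by blast
qed

lemma circle_t_poly_generates: "\<exists>n p. circle_t ^ n * b = circle_t_poly p"
proof -
  define Q where "Q = (\<lambda>b. \<exists>n p. circle_t ^ n * b = circle_t_poly p)"
  have add: "Q (b + c)" if bc: "Q b" "Q c" for b c
  proof -
    obtain n p m q where eq: "circle_t ^ n * b = circle_t_poly p" "circle_t ^ m * c = circle_t_poly q"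
      using bc unfolding Q_def by blast
    have "circle_t ^ (n + m) * (b + c)
        = circle_t ^ m * (circle_t ^ n * b) + circle_t ^ n * (circle_t ^ m * c)"
      by (simp add: power_add algebra_simps)
    also have "\<dots> = circle_t ^ m * circle_t_poly p + circle_t ^ n * circle_t_poly q"
      by (simp only: eq)
    also have "\<dots> = circle_t_poly ([:0, 1:] ^ m * p + [:0, 1:] ^ n * q)"
      by (simp only: circle_t_poly_power circle_t_poly_mult circle_t_poly_add)
    finally show ?thesis unfolding Q_def by blast
  qed
  have mult: "Q (b * c)" if bc: "Q b" "Q c" for b c
  proof -
    obtain n p m q where eq: "circle_t ^ n * b = circle_t_poly p" "circle_t ^ m * c = circle_t_poly q"
      using bc unfolding Q_def by blast
    have "circle_t ^ (n + m) * (b * c) = (circle_t ^ n * b) * (circle_t ^ m * c)"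
      by (simp add: power_add mult_ac)
    also have "\<dots> = circle_t_poly (p * q)" by (simp only: eq circle_t_poly_mult)
    finally show ?thesis unfolding Q_def by blast
  qed
  have const: "Q (circle_cconst z)" for z
    unfolding Q_def by (intro exI[of _ 0] exI[of _ "[:z:]"]) simp
  have "Q (circle_t_poly [:0, 1:])" unfolding Q_def by (metis mult_1 power_0)
  then have t: "Q circle_t" by simp
  have "circle_t ^ 1 * Cx circle_x (- circle_y) = circle_t_poly [:1:]"
    using circle_t_inverse by (simp del: one_poly_eq_simps)
  then have s: "Q (Cx circle_x (- circle_y))" unfolding Q_def by blast
  have half: "circle_const (1/2) * a + circle_const (1/2) * a = a" for a
    by (metis circle_const_simps(2,3) distrib_right field_sum_of_halves mult_1)
  have "Cx circle_x 0 = circle_cconst (1/2) * (circle_t + Cx circle_x (- circle_y))"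
    by (simp add: cplx_eq_iff circle_cconst_def circle_t_def distrib_left half)
  then have x: "Q (Cx circle_x 0)" using add mult const t s by simp
  have "Cx circle_y 0 = circle_cconst (- \<i>/2) * (circle_t + circle_cconst (- 1) * Cx circle_x (- circle_y))"
    by (simp add: cplx_eq_iff circle_cconst_def circle_t_def distrib_left half)
  then have y: "Q (Cx circle_y 0)" using add mult const t s by metis
  have Cx_add: "Cx (a + b) 0 = Cx a 0 + Cx b 0" and Cx_mult: "Cx (a * b) 0 = Cx a 0 * Cx b 0"
    for a b :: circle_ring by (simp_all add: cplx_eq_iff)
  have real: "Q (Cx (circle_const c) 0)" for c
    using const[of "of_real c"] by (simp add: circle_cconst_def)
  have 1: "Q (Cx (abs_circle_ring [:c:]) 0)" for c
  proof (induction c)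
    case 0
    then show ?case using real[of 0] by (simp add: zero_circle_ring.abs_eq)
  next
    case (pCons a c)
    have "abs_circle_ring [:pCons a c:] = circle_const a + circle_x * abs_circle_ring [:c:]"
      by (simp add: circle_const.abs_eq circle_x.abs_eq plus_circle_ring.abs_eq times_circle_ring.abs_eq)
    then show ?case using pCons add mult x real by (simp add: Cx_add Cx_mult)
  qed
  have 2: "Q (Cx (abs_circle_ring p) 0)" for p
  proof (induction p)
    case 0
    then show ?case using 1[of 0] by simp
  next
    case (pCons c p)
    have "abs_circle_ring (pCons c p) = abs_circle_ring [:c:] + circle_y * abs_circle_ring p"
      by (simp add: circle_y.abs_eq plus_circle_ring.abs_eq times_circle_ring.abs_eq)
    then show ?case using pCons add mult y 1 by (simp add: Cx_add Cx_mult)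
  qed
  have 3: "Q (Cx a 0)" for a using 2 Quotient3_abs_rep[OF Quotient3_circle_ring] by metis
  have "b = Cx (cx_re b) 0 + circle_cconst \<i> * Cx (cx_im b) 0"
    by (simp add: cplx_eq_iff circle_cconst_def)
  then have "Q b" using add mult const 3 by metis
  then show ?thesis by (simp add: Q_def)
qed

lemma circle_t_minus_cconst_nonzero: "circle_t - circle_cconst z \<noteq> 0"
proof
  assume "circle_t - circle_cconst z = 0"
  then have "circle_t_poly [:- z, 1:] = 0" by (simp del: one_poly_eq_simps)
  then show False using circle_t_poly_inject by fastforce
qed

end

(* Conjugation of B maps t - z to a unit times t - 1/cnj z for z \<noteq> 0.  Since b * conj b lies in A,
   the classes of t - z and t - 1/cnj z are inverse to each other; moreover all the classes [t - z]
   with |z| = 1 coincide, so that G has at most two elements.  As C is algebraically closed, this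
   gives P = G H.  For the freeness of H, the homomorphism ord_z - ord_{1/cnj z} on L* vanishes on
   B* K* and reads off the exponent of [t - z] for 0 < |z| < 1.  Finally, G is a torsion group and H
   is torsion-free, hence G and H meet trivially. *)
theory Submission
  imports Defs "HOL-Computational_Algebra.Fundamental_Theorem_Algebra"
begin

section \<open>Conjugation\<close>

definition cplx_conj :: "'a::comm_ring_1 cplx \<Rightarrow> 'a cplx" where
  "cplx_conj b = Cx (cx_re b) (- cx_im b)"

lemma cplx_conj_sel [simp]: "cx_re (cplx_conj b) = cx_re b" "cx_im (cplx_conj b) = - cx_im b"
  by (simp_all add: cplx_conj_def)

lemma cplx_conj_conj [simp]: "cplx_conj (cplx_conj b) = b"
  by (simp add: cplx_eq_iff)

lemma cplx_conj_eq_0_iff [simp]: "cplx_conj b = 0 \<longleftrightarrow> b = 0"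
  by (simp add: cplx_eq_iff)

lemma cplx_conj_diff [simp]: "cplx_conj (b - c) = cplx_conj b - cplx_conj c"
  by (simp add: cplx_eq_iff)

lemma cplx_conj_mult [simp]: "cplx_conj (b * c) = cplx_conj b * cplx_conj c"
  by (simp add: cplx_eq_iff)

lemma cplx_conj_1 [simp]: "cplx_conj 1 = 1"
  by (simp add: cplx_eq_iff)

lemma cplx_conj_power [simp]: "cplx_conj (b ^ n) = cplx_conj b ^ n"
  by (induction n) simp_all

lemma mult_cplx_conj: "b * cplx_conj b = Cx (cx_re b * cx_re b + cx_im b * cx_im b) 0"
  by (simp add: cplx_eq_iff)

lemma cplx_conj_cconst [simp]: "cplx_conj (circle_cconst z) = circle_cconst (cnj z)"
  by (simp add: cplx_eq_iff circle_cconst_def)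

text \<open>On the circle the conjugate \<open>x - i y\<close> of \<open>t\<close> is its inverse,
  so \<open>cplx_conj circle_t\<close> stands for the inverse of \<open>t\<close>
  throughout.\<close>

lemma circle_t_mult_conj: "circle_t * cplx_conj circle_t = 1"
  using circle_t_inverse by (simp add: cplx_conj_def circle_t_def)

lemma circle_t_power_mult_conj: "circle_t ^ n * cplx_conj circle_t ^ n = 1"
  by (simp flip: power_mult_distrib add: circle_t_mult_conj)

lemma circle_t_nonzero [simp]: "circle_t \<noteq> 0"
  using circle_t_mult_conj by auto

lemma circle_cconst_dvd_1: "z \<noteq> 0 \<Longrightarrow> circle_cconst z dvd 1"
  by (rule dvdI[of _ _ "circle_cconst (1 / z)"]) (simp flip: circle_cconst_simps)

text \<open>As conjugation inverts \<open>t\<close>, the image is \<open>1/t - cnj z\<close>. Taking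
  out the unit \<open>- cnj z / t\<close> leaves a linear factor with root \<open>1 / cnj z\<close>,
  the mirror image of \<open>z\<close> in the unit circle.\<close>

lemma circle_conj_linear:
  assumes "z \<noteq> 0"
  shows "cplx_conj (circle_t - circle_cconst z)
       = circle_cconst (- cnj z) * cplx_conj circle_t * (circle_t - circle_cconst (1 / cnj z))"
proof -
  have 1: "circle_cconst (cnj z) * circle_cconst (1 / cnj z) = 1"
    using assms by (simp flip: circle_cconst_simps)
  have "circle_cconst (- cnj z) * cplx_conj circle_t * (circle_t - circle_cconst (1 / cnj z))
      = - circle_cconst (cnj z) * (circle_t * cplx_conj circle_t)
        + (circle_cconst (cnj z) * circle_cconst (1 / cnj z)) * cplx_conj circle_t"
    by (simp add: algebra_simps)
  then show ?thesis
    unfolding circle_t_mult_conj 1 by simp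
qed

text \<open>The imaginary part equals its own negative, and 2 is invertible in the coordinate ring,
  with the constant \<open>1/2\<close> as inverse.\<close>

lemma circle_conj_fixed_real:
  assumes "cplx_conj b = (b :: circle_ring cplx)"
  shows "\<exists>a. b = Cx a 0"
proof -
  have "- cx_im b = cx_im b" using assms by (metis cplx_conj_sel(2))
  then have "cx_im b + cx_im b = 0" by (metis add.right_inverse)
  moreover have "circle_const (1/2) * (cx_im b + cx_im b) = cx_im b"
    by (metis circle_const_simps(2,3) distrib_left distrib_right field_sum_of_halves mult_1)
  ultimately have "cx_im b = 0" by (metis mult_zero_right)
  then have "b = Cx (cx_re b) 0" by (simp add: cplx_eq_iff)
  then show ?thesis ..
qed

lemma circle_t_poly_1: "circle_t_poly 1 = 1"
  using circle_t_poly_power[of 0] by simp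

lemma circle_t_poly_linear: "circle_t_poly [:- z, 1:] = circle_t - circle_cconst z"
  by (simp del: one_poly_eq_simps)

section \<open>Orders of vanishing\<close>

text \<open>Powers of \<open>X\<close> vanish at 0 only. This makes the order of a Laurent
  polynomial at a nonzero point independent of how its denominator is cleared.\<close>

lemma order_X_power_mult:
  assumes "z \<noteq> (0::complex)"
  shows "Polynomial.order z ([:0, 1:] ^ n * p) = Polynomial.order z p"
proof (cases "p = 0")
  case False
  moreover have "Polynomial.order z ([:0, 1:] ^ n) = 0"
    using assms by (intro order_0I) simp
  ultimately show ?thesis by (subst order_mult) simp_all
qed simp

text \<open>An element of \<open>B\<close> is a Laurent polynomial in \<open>t\<close>; its order at
  \<open>z\<close> is read off after a power of \<open>t\<close> has cleared the negative exponents.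
  As that power is not unique, the value is meaningful for \<open>z \<noteq> 0\<close>.\<close>

definition circle_order :: "complex \<Rightarrow> circle_ring cplx \<Rightarrow> nat" where
  "circle_order z b = Polynomial.order z (SOME p. \<exists>n. circle_t ^ n * b = circle_t_poly p)"

text \<open>Cross-multiplying two choices gives polynomials with the same value at \<open>t\<close>.
  They are equal because \<open>t\<close> is transcendental over the constants, and the extra powers
  of \<open>X\<close> do not affect orders away from 0.\<close>

lemma circle_order_eq:
  assumes "z \<noteq> 0" and p: "circle_t ^ n * b = circle_t_poly p"
  shows "circle_order z b = Polynomial.order z p"
proof -
  define q where "q = (SOME p. \<exists>n. circle_t ^ n * b = circle_t_poly p)"
  have "\<exists>m. circle_t ^ m * b = circle_t_poly q"
    unfolding q_def by (rule someI) (use p in blast)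
  then obtain m where q: "circle_t ^ m * b = circle_t_poly q" ..
  have "circle_t_poly ([:0, 1:] ^ m * p) = circle_t_poly ([:0, 1:] ^ n * q)"
    by (simp only: circle_t_poly_mult flip: circle_t_poly_power p q) (simp add: mult_ac)
  \<comment> \<open>The difference is written as a sum with the scalar \<open>-1\<close>, so that
    additivity and homogeneity of \<open>circle_t_poly\<close> apply.\<close>
  then have "circle_t_poly ([:0, 1:] ^ m * p + smult (-1) ([:0, 1:] ^ n * q)) = 0"
    by (simp only: circle_t_poly_add circle_t_poly_smult) simp
  then have "[:0, 1:] ^ m * p = [:0, 1:] ^ n * q"
    using circle_t_poly_inject by force
  then show ?thesis
    using order_X_power_mult[OF assms(1)] unfolding circle_order_def q_def[symmetric] by metis
qed

lemma circle_order_mult: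
  assumes "z \<noteq> 0" "b \<noteq> 0" "c \<noteq> 0"
  shows "circle_order z (b * c) = circle_order z b + circle_order z c"
proof -
  obtain n p m q where p: "circle_t ^ n * b = circle_t_poly p" and q: "circle_t ^ m * c = circle_t_poly q"
    using circle_t_poly_generates by metis
  have "circle_t ^ (n + m) * (b * c) = (circle_t ^ n * b) * (circle_t ^ m * c)"
    by (simp add: power_add mult_ac)
  then have pq: "circle_t ^ (n + m) * (b * c) = circle_t_poly (p * q)"
    by (simp only: p q circle_t_poly_mult)
  have "p \<noteq> 0" "q \<noteq> 0"
    using p q assms by auto
  then show ?thesis
    by (simp add: circle_order_eq[OF assms(1) p] circle_order_eq[OF assms(1) q]
        circle_order_eq[OF assms(1) pq] order_mult)
qed

lemma circle_order_1: "z \<noteq> 0 \<Longrightarrow> circle_order z 1 = 0"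
  using circle_order_eq[of z 0 1 1] by (simp add: circle_t_poly_1)

lemma circle_order_power:
  "z \<noteq> 0 \<Longrightarrow> b \<noteq> 0 \<Longrightarrow> circle_order z (b ^ n) = n * circle_order z b"
  by (induction n) (simp_all add: circle_order_1 circle_order_mult)

lemma circle_order_unit:
  assumes "z \<noteq> 0" "b dvd 1"
  shows "circle_order z b = 0"
proof -
  obtain c where "1 = b * c" using assms(2) by (rule dvdE)
  then show ?thesis
    using circle_order_mult[of z b c] circle_order_1[of z] assms(1) by fastforce
qed

lemma circle_order_linear:
  assumes "z \<noteq> 0"
  shows "circle_order z (circle_t - circle_cconst w) = (if z = w then 1 else 0)"
proof -
  have "circle_t ^ 0 * (circle_t - circle_cconst w) = circle_t_poly [:- w, 1:]"
    by (simp only: circle_t_poly_linear power_0 mult_1)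
  then have "circle_order z (circle_t - circle_cconst w) = Polynomial.order z [:- w, 1:]"
    using circle_order_eq assms by blast
  moreover have "Polynomial.order w [:- w, 1:] = 1"
    using order_power_n_n[of w 1] by simp
  moreover have "Polynomial.order z [:- w, 1:] = 0" if "z \<noteq> w"
    using that by (intro order_0I) simp
  ultimately show ?thesis by simp
qed

text \<open>A power of \<open>t\<close> clears denominators, the linear factors are split off in the
  polynomial ring, and the inverse power, written with the conjugate of \<open>t\<close>, undoes the
  clearing.\<close>

lemma circle_order_decomp:
  assumes "z \<noteq> 0"
  shows "\<exists>c. b = (circle_t - circle_cconst z) ^ circle_order z b * c"
proof -
  obtain n p where p: "circle_t ^ n * b = circle_t_poly p"
    using circle_t_poly_generates by metis
  define k where "k = circle_order z b"
  have k: "k = Polynomial.order z p"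
    unfolding k_def using circle_order_eq[OF assms p] .
  have lin: "circle_t_poly ([:- z, 1:] ^ m) = (circle_t - circle_cconst z) ^ m" for m
    by (induction m)
      (simp_all only: power_0 power_Suc circle_t_poly_1 circle_t_poly_mult circle_t_poly_linear)
  obtain r where "p = [:- z, 1:] ^ k * r"
    using order_1[of z p] unfolding k by (auto elim: dvdE)
  then have "circle_t ^ n * b = (circle_t - circle_cconst z) ^ k * circle_t_poly r"
    using p by (simp only: circle_t_poly_mult lin)
  then have "cplx_conj circle_t ^ n * (circle_t ^ n * b)
      = (circle_t - circle_cconst z) ^ k * (cplx_conj circle_t ^ n * circle_t_poly r)"
    by (simp add: mult_ac)
  moreover have "cplx_conj circle_t ^ n * (circle_t ^ n * b) = b"
    using circle_t_power_mult_conj[of n] by (metis mult.assoc mult.commute mult_1)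
  ultimately show ?thesis unfolding k_def by metis
qed

text \<open>Conjugation turns the factor \<open>(t - z)^k\<close> into a unit times
  \<open>(t - w)^k\<close> with \<open>w = 1 / cnj z\<close>. An inequality suffices, since passing
  to the mirror point is an involution.\<close>

lemma circle_order_conj_le:
  assumes "z \<noteq> 0" "b \<noteq> 0"
  shows "circle_order z b \<le> circle_order (1 / cnj z) (cplx_conj b)"
proof -
  define k w where "k = circle_order z b" and "w = 1 / cnj z"
  have w: "w \<noteq> 0" using assms by (simp add: w_def)
  obtain c where c: "b = (circle_t - circle_cconst z) ^ k * c"
    unfolding k_def using circle_order_decomp[OF assms(1)] by blast
  define d where "d = (circle_cconst (- cnj z) * cplx_conj circle_t) ^ k * cplx_conj c"
  have "cplx_conj b = (circle_t - circle_cconst w) ^ k * d"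
    unfolding c cplx_conj_mult cplx_conj_power circle_conj_linear[OF assms(1)] d_def w_def
    by (simp only: power_mult_distrib mult_ac)
  moreover from this have "d \<noteq> 0" using assms(2) by (metis cplx_conj_eq_0_iff mult_zero_right)
  ultimately have "circle_order w (cplx_conj b) = k + circle_order w d"
    using w circle_t_minus_cconst_nonzero
    by (simp add: circle_order_mult circle_order_power circle_order_linear)
  then show ?thesis unfolding k_def w_def by simp
qed

text \<open>Conjugation fixes the elements of \<open>A\<close>, so the preceding inequality holds in
  both directions between mirror points.\<close>

lemma circle_order_real:
  assumes "z \<noteq> 0" "a \<noteq> 0"
  shows "circle_order z (Cx a 0) = circle_order (1 / cnj z) (Cx a 0)"
proof -
  have nz: "Cx a 0 \<noteq> 0" using assms by (simp add: cplx_eq_iff)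
  have "cplx_conj (Cx a 0) = Cx a 0" by (simp add: cplx_eq_iff)
  then show ?thesis
    using circle_order_conj_le[OF assms(1) nz] circle_order_conj_le[of "1 / cnj z", OF _ nz] assms(1)
    by simp
qed

section \<open>Orders on the fraction field and their antisymmetric combination\<close>

definition fract_order :: "complex \<Rightarrow> circle_ring cplx fract \<Rightarrow> int" where
  "fract_order z x = (SOME k. \<exists>a b. a \<noteq> 0 \<and> b \<noteq> 0 \<and> x = Fract a b \<and>
     k = int (circle_order z a) - int (circle_order z b))"

text \<open>Equal fractions satisfy \<open>a * d = c * b\<close>, and additivity of the order then
  gives the same difference for both.\<close>

lemma fract_order_Fract:
  assumes "z \<noteq> 0" "a \<noteq> 0" "b \<noteq> 0"
  shows "fract_order z (Fract a b) = int (circle_order z a) - int (circle_order z b)"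
  unfolding fract_order_def
proof (rule some_equality)
  fix k assume "\<exists>c d. c \<noteq> 0 \<and> d \<noteq> 0 \<and> Fract a b = Fract c d \<and>
    k = int (circle_order z c) - int (circle_order z d)"
  then obtain c d where cd: "c \<noteq> 0" "d \<noteq> 0" "Fract a b = Fract c d"
    and k: "k = int (circle_order z c) - int (circle_order z d)" by blast
  then have "a * d = c * b" using assms by (simp add: eq_fract)
  then have "circle_order z a + circle_order z d = circle_order z c + circle_order z b"
    using circle_order_mult assms cd by metis
  then show "k = int (circle_order z a) - int (circle_order z b)" using k by simp
qed (use assms in blast)

lemma fract_order_to_fract:
  "z \<noteq> 0 \<Longrightarrow> b \<noteq> 0 \<Longrightarrow> fract_order z (to_fract b) = int (circle_order z b)"
  by (simp add: to_fract_def fract_order_Fract circle_order_1)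

lemma fract_order_mult:
  assumes "z \<noteq> 0" "x \<noteq> 0" "y \<noteq> 0"
  shows "fract_order z (x * y) = fract_order z x + fract_order z y"
proof -
  have *: "\<exists>a b. u = Fract a b \<and> a \<noteq> 0 \<and> b \<noteq> 0" if "u \<noteq> 0" for u :: "circle_ring cplx fract"
    using that by (cases u rule: Fract_cases_nonzero) auto
  obtain a b c d where "x = Fract a b" "y = Fract c d" "a \<noteq> 0" "b \<noteq> 0" "c \<noteq> 0" "d \<noteq> 0"
    using *[OF assms(2)] *[OF assms(3)] by blast
  then show ?thesis
    using assms(1) by (simp add: fract_order_Fract circle_order_mult)
qed

text \<open>The order at the mirror point is subtracted so that elements of \<open>K\<close>, whose
  zeros and poles lie symmetrically, contribute 0 and the map descends to the polar group.\<close>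

definition polar_order :: "complex \<Rightarrow> circle_ring cplx fract \<Rightarrow> int" where
  "polar_order z x = fract_order z x - fract_order (1 / cnj z) x"

lemma polar_order_hom:
  assumes "z \<noteq> 0"
  shows "polar_order z \<in> hom mult_group integer_group"
  using assms by (intro homI) (auto simp: mult_group_def polar_order_def fract_order_mult)

text \<open>Units of \<open>B\<close> have order 0 at every nonzero point, and a fraction with
  numerator and denominator in \<open>A\<close> has equal orders at mirror points.\<close>

lemma polar_order_kernel:
  assumes "z \<noteq> 0" "x \<in> polar_kernel"
  shows "polar_order z x = 0"
proof -
  have z': "1 / cnj z \<noteq> 0" using assms by simp
  obtain u k where x: "x = u * k" and u: "u \<in> units_in_L" and k: "k \<in> K_in_L" "k \<noteq> 0"
    using assms(2) unfolding polar_kernel_def set_mult_def by (auto simp: mult_group_def)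
  obtain b where b: "u = to_fract b" "b dvd 1" using u by (auto simp: units_in_L_def)
  then have b0: "b \<noteq> 0" by auto
  have "polar_order z u = 0"
    unfolding polar_order_def b(1) using assms(1) z' b0 b(2)
    by (simp add: fract_order_to_fract circle_order_unit)
  moreover have "polar_order z k = 0"
  proof -
    obtain c d where cd: "k = Fract (Cx c 0) (Cx d 0)" "d \<noteq> 0" using k by (auto simp: K_in_L_def)
    have "c \<noteq> 0"
    proof
      assume "c = 0"
      then have "k = Fract 0 (Cx d 0)" using cd by (simp add: zero_cplx_def)
      with k show False by (simp add: fract_collapse)
    qed
    moreover have "Cx c 0 \<noteq> 0" "Cx d 0 \<noteq> 0" using \<open>c \<noteq> 0\<close> cd by (simp_all add: cplx_eq_iff)
    ultimately show ?thesis
      unfolding polar_order_def cd(1) using assms(1) z' cd(2)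
      by (simp add: fract_order_Fract circle_order_real[of z])
  qed
  moreover have "u \<noteq> 0" using b b0 by simp
  ultimately show ?thesis
    unfolding x polar_order_def using assms(1) z' k(2) by (simp add: fract_order_mult)
qed

section \<open>Classes in the polar group\<close>

lemma polar_class_hom:
  "(\<lambda>x. polar_kernel #>\<^bsub>mult_group\<^esub> x) \<in> hom mult_group (polar_group TYPE('a::polar_idom))"
proof -
  interpret comm_group "mult_group :: 'a cplx fract monoid" by (rule comm_group_mult_group)
  interpret normal "polar_kernel :: 'a cplx fract set" mult_group
    using subgroup_imp_normal[OF subgroup_polar_kernel] .
  show ?thesis unfolding polar_group_def by (rule r_coset_hom_Mod)
qed

lemma polar_class_mult:
  fixes f g :: "'a::polar_idom cplx"
  assumes "f \<noteq> 0" "g \<noteq> 0"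
  shows "polar_class (f * g) = polar_class f \<otimes>\<^bsub>polar_group TYPE('a)\<^esub> polar_class g"
  using hom_mult[OF polar_class_hom[where 'a='a], of "to_fract f" "to_fract g"] assms
  by (simp add: polar_class_def mult_group_def)

text \<open>Here \<open>f\<close> is the inverse of the unit \<open>u\<close> times an element of
  \<open>A\<close>, a product of the shape that defines the kernel. Relations between classes are
  proved by exhibiting such a \<open>u\<close>.\<close>

lemma polar_class_eq_one:
  fixes f u :: "'a::polar_idom cplx"
  assumes u: "u dvd 1" and f: "f \<noteq> 0" "f * u = Cx a 0"
  shows "polar_class f = \<one>\<^bsub>polar_group TYPE('a)\<^esub>"
proof -
  interpret comm_group "mult_group :: 'a cplx fract monoid" by (rule comm_group_mult_group)
  obtain v where v: "1 = u * v" using u by (rule dvdE)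
  then have "v dvd 1" by (metis dvd_triv_right)
  then have 1: "to_fract v \<in> units_in_L" by (auto simp: units_in_L_def)
  have "u \<noteq> 0" using v by auto
  then have "Cx a 0 \<noteq> 0" using f by (metis no_zero_divisors)
  moreover have "to_fract (Cx a 0) \<in> K_in_L"
    unfolding K_in_L_def to_fract_def one_cplx_def by (metis (mono_tags, lifting) mem_Collect_eq zero_neq_one)
  ultimately have 2: "to_fract (Cx a 0) \<in> K_in_L - {0}" by (metis DiffI singletonD to_fract_eq_0_iff)
  have "f = v * Cx a 0" using v f(2) by (metis mult.assoc mult.commute mult_1)
  then have "to_fract f = to_fract v * to_fract (Cx a 0)" by simp
  then have "to_fract f = to_fract v \<otimes>\<^bsub>mult_group\<^esub> to_fract (Cx a 0)"
    by (simp add: mult_group_def)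
  then have "to_fract f \<in> polar_kernel"
    unfolding polar_kernel_def set_mult_def using 1 2 by blast
  then show ?thesis
    unfolding polar_class_def polar_group_def
    using coset_join2[OF _ subgroup_polar_kernel] f(1) by (simp add: mult_group_def)
qed

lemma polar_class_unit:
  fixes b :: "'a::polar_idom cplx"
  assumes "b dvd 1"
  shows "polar_class b = \<one>\<^bsub>polar_group TYPE('a)\<^esub>"
proof -
  obtain c where c: "1 = b * c" using assms by (rule dvdE)
  show ?thesis
  proof (rule polar_class_eq_one)
    show "c dvd 1" using c by (metis dvd_triv_right)
    show "b \<noteq> 0" using c by auto
    show "b * c = Cx 1 0" using c by (simp add: one_cplx_def)
  qed
qed

section \<open>Relations between the classes of linear factors\<close>

abbreviation circle_class :: "complex \<Rightarrow> circle_ring cplx fract set" where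
  "circle_class z \<equiv> polar_class (circle_t - circle_cconst z)"

abbreviation circle_polar :: "circle_ring cplx fract set monoid" where
  "circle_polar \<equiv> polar_group TYPE(circle_ring)"

lemma circle_class_carrier: "circle_class z \<in> carrier circle_polar"
  using polar_class_in_carrier circle_t_minus_cconst_nonzero by blast

lemma circle_conj_t_dvd_1: "cplx_conj circle_t dvd 1"
  using circle_t_mult_conj by (metis dvd_triv_right)

text \<open>The norm \<open>(t - z) * cplx_conj (t - z)\<close> lies in \<open>A\<close>, and its
  second factor is a unit times \<open>t - 1 / cnj z\<close>.\<close>

lemma circle_class_mult_reflection:
  assumes "z \<noteq> 0"
  shows "circle_class z \<otimes>\<^bsub>circle_polar\<^esub> circle_class (1 / cnj z) = \<one>\<^bsub>circle_polar\<^esub>"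
proof -
  define f where "f = (circle_t - circle_cconst z) * (circle_t - circle_cconst (1 / cnj z))"
  define u where "u = circle_cconst (- cnj z) * cplx_conj circle_t"
  have "f * u = (circle_t - circle_cconst z) * cplx_conj (circle_t - circle_cconst z)"
    unfolding circle_conj_linear[OF assms] f_def u_def by (simp only: mult_ac)
  then have fu: "\<exists>a. f * u = Cx a 0" by (simp only: mult_cplx_conj) blast
  have u: "u dvd 1"
    using mult_dvd_mono[OF circle_cconst_dvd_1 circle_conj_t_dvd_1] assms unfolding u_def by force
  have f: "f \<noteq> 0" unfolding f_def using circle_t_minus_cconst_nonzero by (metis no_zero_divisors)
  have "polar_class f = \<one>\<^bsub>circle_polar\<^esub>"
    using polar_class_eq_one[OF u f] fu by blast
  then show ?thesis
    unfolding f_def using polar_class_mult circle_t_minus_cconst_nonzero by metis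
qed

text \<open>For \<open>\<bar>z\<bar> = \<bar>w\<bar> = 1\<close>, conjugation multiplies \<open>t\<^sup>-\<^sup>1 (t - z) (t - w)\<close> by \<open>cnj (z w)\<close>, so that
  dividing it by a square root of \<open>z w\<close> makes it real.\<close>

lemma circle_class_mult_unit_circle:
  assumes "norm z = 1" "norm w = 1"
  shows "circle_class z \<otimes>\<^bsub>circle_polar\<^esub> circle_class w = \<one>\<^bsub>circle_polar\<^esub>"
proof -
  have inv: "1 / cnj v = v" if "norm v = 1" for v
    using that complex_norm_square[of v] by (auto simp: divide_eq_eq)
  have nz: "z \<noteq> 0" "w \<noteq> 0" using assms by auto
  define d where "d = csqrt (z * w)"
  have dd: "d * d = z * w" unfolding d_def by (simp flip: power2_eq_square)
  have nd: "norm d = 1" unfolding d_def using assms by (simp add: norm_csqrt norm_mult)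
  then have d0: "cnj d \<noteq> 0" by auto
  define f where "f = (circle_t - circle_cconst z) * (circle_t - circle_cconst w)"
  define u where "u = circle_cconst (cnj d) * cplx_conj circle_t"
  have c: "d * cnj z * cnj w = cnj d"
  proof -
    have "d * cnj z * cnj w = d * cnj (d * d)" by (simp only: dd) simp
    also have "\<dots> = (d * cnj d) * cnj d" by simp
    also have "d * cnj d = 1" using complex_norm_square[of d] nd by simp
    finally show ?thesis by simp
  qed
  have "cplx_conj (f * u) = circle_cconst d * circle_t
      * (circle_cconst (- cnj z) * cplx_conj circle_t * (circle_t - circle_cconst z))
      * (circle_cconst (- cnj w) * cplx_conj circle_t * (circle_t - circle_cconst w))"
    unfolding f_def u_def cplx_conj_mult circle_conj_linear[OF nz(1)] circle_conj_linear[OF nz(2)]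
    by (simp only: inv assms cplx_conj_conj cplx_conj_cconst complex_cnj_cnj mult_ac)
  also have "\<dots> = circle_cconst (d * cnj z * cnj w) * (circle_t * cplx_conj circle_t)
      * cplx_conj circle_t * f"
    unfolding f_def by (simp add: mult_ac)
  also have "\<dots> = f * u"
    unfolding c circle_t_mult_conj u_def by (simp add: mult_ac)
  finally obtain a where fu: "f * u = Cx a 0"
    using circle_conj_fixed_real by blast
  have u: "u dvd 1"
    using mult_dvd_mono[OF circle_cconst_dvd_1[OF d0] circle_conj_t_dvd_1] unfolding u_def by simp
  have f: "f \<noteq> 0" unfolding f_def using circle_t_minus_cconst_nonzero by (metis no_zero_divisors)
  show ?thesis
    using polar_class_eq_one[OF u f fu]
    unfolding f_def using polar_class_mult circle_t_minus_cconst_nonzero by metis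
qed

text \<open>By the product relation on the unit circle, both classes are inverse to the class of
  \<open>t - 1\<close>.\<close>

lemma circle_class_unit_circle:
  assumes "norm z = 1"
  shows "circle_class z = circle_class 1"
proof -
  interpret P: comm_group circle_polar by (rule comm_group_polar_group)
  have "circle_class z \<otimes>\<^bsub>circle_polar\<^esub> circle_class 1 = circle_class 1 \<otimes>\<^bsub>circle_polar\<^esub> circle_class 1"
    using circle_class_mult_unit_circle[of z 1] circle_class_mult_unit_circle[of 1 1] assms by simp
  then show ?thesis
    using circle_class_carrier by (metis P.right_cancel)
qed

section \<open>Coefficient homomorphisms on the polar group\<close>

lemma circle_polar_coefficient:
  assumes "0 < norm z" "norm z < 1"
  obtains \<psi> where "\<psi> \<in> hom circle_polar integer_group"
    "\<And>w. 0 < norm w \<Longrightarrow> norm w < 1 \<Longrightarrow> \<psi> (circle_class w) = (if z = w then 1 else 0)"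
proof -
  have z: "z \<noteq> 0" using assms by auto
  interpret L: comm_group "mult_group :: circle_ring cplx fract monoid" by (rule comm_group_mult_group)
  interpret h: group_hom mult_group integer_group "polar_order z"
    by (intro group_hom.intro group_hom_axioms.intro polar_order_hom z) simp_all
  \<comment> \<open>Being trivial on the polar kernel, \<open>polar_order z\<close> factors through
    the quotient.\<close>
  have "polar_kernel \<subseteq> kernel mult_group integer_group (polar_order z)"
    using subgroup.subset[OF subgroup_polar_kernel] polar_order_kernel[OF z]
    by (auto simp: kernel_def)
  then obtain \<psi> where hom: "\<psi> \<in> hom circle_polar integer_group"
    and \<psi>: "\<And>x. x \<in> carrier mult_group \<Longrightarrow> \<psi> (polar_kernel #>\<^bsub>mult_group\<^esub> x) = polar_order z x"
    using h.FactGroup_universal_kernel[OF L.subgroup_imp_normal[OF subgroup_polar_kernel]]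
    unfolding polar_group_def by metis
  have "\<psi> (circle_class w) = (if z = w then 1 else 0)" if w: "0 < norm w" "norm w < 1" for w
  proof -
    have nz: "circle_t - circle_cconst w \<noteq> 0" by (rule circle_t_minus_cconst_nonzero)
    then have "\<psi> (circle_class w) = polar_order z (to_fract (circle_t - circle_cconst w))"
      unfolding polar_class_def by (intro \<psi>) (simp add: mult_group_def del: to_fract_diff)
    \<comment> \<open>The mirror point lies outside the unit disc, so the subtracted order of
      \<open>t - w\<close> is 0 and only the order at \<open>z\<close> counts.\<close>
    moreover have "1 / cnj z \<noteq> w"
    proof
      assume "1 / cnj z = w"
      then have "norm w = 1 / norm z" by (auto simp: norm_divide)
      moreover have "1 / norm z > 1" using assms by simp
      ultimately show False using w by simp
    qed
    ultimately show ?thesis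
      unfolding polar_order_def using z nz
      by (simp add: fract_order_to_fract circle_order_linear del: to_fract_diff)
  qed
  with hom show ?thesis using that by blast
qed

section \<open>Generation by linear classes\<close>

lemma polar_class_poly_in_subgroup:
  assumes M: "subgroup M circle_polar"
    and cls: "\<And>z. z \<noteq> 0 \<Longrightarrow> circle_class z \<in> M"
    and "p \<noteq> 0"
  shows "polar_class (circle_t_poly p) \<in> M"
  using assms(3)
proof (induction "degree p" arbitrary: p)
  case 0
  then obtain c where "p = [:c:]" "c \<noteq> 0" by (metis degree_0_id pCons_eq_0_iff)
  then have "polar_class (circle_t_poly p) = \<one>\<^bsub>circle_polar\<^esub>"
    using polar_class_unit[OF circle_cconst_dvd_1] by simp
  then show ?case using subgroup.one_closed[OF M] by simp
next
  case (Suc n)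
  \<comment> \<open>A nonconstant polynomial has a complex root, and splitting off its linear factor
    lowers the degree by one.\<close>
  then obtain z where "poly p z = 0"
    using fundamental_theorem_of_algebra[of p] constant_degree[of p] by auto
  then obtain q where p: "p = [:- z, 1:] * q" by (auto simp: poly_eq_0_iff_dvd elim: dvdE)
  have q: "q \<noteq> 0" using p Suc.prems by auto
  have "degree p = Suc (degree q)" unfolding p using q by (subst degree_mult_eq) auto
  then have IH: "polar_class (circle_t_poly q) \<in> M" using Suc.hyps q by simp
  have "circle_t_poly q \<noteq> 0" using q circle_t_poly_inject by blast
  then have "polar_class (circle_t_poly p) = circle_class z \<otimes>\<^bsub>circle_polar\<^esub> polar_class (circle_t_poly q)"
    unfolding p circle_t_poly_mult circle_t_poly_linear
    using polar_class_mult circle_t_minus_cconst_nonzero by blast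
  moreover have "circle_class z \<in> M"
  proof (cases "z = 0")
    case True
    \<comment> \<open>A root at 0 contributes \<open>t\<close> itself, which is a unit, so its class
      is trivial.\<close>
    have "circle_t dvd 1" using circle_t_mult_conj by (metis dvd_triv_left)
    then show ?thesis using True polar_class_unit[of circle_t] subgroup.one_closed[OF M] by simp
  qed (rule cls)
  ultimately show ?case using IH subgroup.m_closed[OF M] by simp
qed

text \<open>A nonzero element of \<open>L\<close> is a quotient of nonzero elements of
  \<open>B\<close>, and each of these is, up to the unit \<open>t^n\<close>, a polynomial in
  \<open>t\<close>, which splits into linear factors.\<close>

lemma circle_polar_generated:
  assumes M: "subgroup M circle_polar"
    and cls: "\<And>z. z \<noteq> 0 \<Longrightarrow> circle_class z \<in> M"
  shows "M = carrier circle_polar"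
proof
  interpret P: comm_group circle_polar by (rule comm_group_polar_group)
  show "M \<subseteq> carrier circle_polar" using subgroup.subset[OF M] .
  have B: "polar_class b \<in> M" if b: "b \<noteq> 0" for b
  proof -
    obtain n p where p: "circle_t ^ n * b = circle_t_poly p"
      using circle_t_poly_generates by metis
    have tn: "circle_t ^ n dvd 1"
      using circle_t_power_mult_conj by (metis dvd_triv_left)
    have "p \<noteq> 0" using p b by auto
    then have "polar_class (circle_t ^ n * b) \<in> M"
      using p polar_class_poly_in_subgroup[OF M cls] by simp
    moreover have "polar_class (circle_t ^ n * b) = polar_class b"
      using polar_class_mult[of "circle_t ^ n" b] polar_class_unit[OF tn] b
        polar_class_in_carrier[OF b] by simp
    ultimately show ?thesis by simp
  qed
  show "carrier circle_polar \<subseteq> M"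
  proof
    fix X assume "X \<in> carrier circle_polar"
    then obtain x where X: "X = polar_kernel #>\<^bsub>mult_group\<^esub> x" and "x \<noteq> 0"
      by (auto simp: polar_group_def FactGroup_def RCOSETS_def mult_group_def)
    then obtain a b where x: "x = Fract a b" "b \<noteq> 0" "a \<noteq> 0"
      by (cases x rule: Fract_cases_nonzero) auto
    have "x * to_fract b = to_fract a"
      using x by (simp add: to_fract_def eq_fract)
    then have "X \<otimes>\<^bsub>circle_polar\<^esub> polar_class b = polar_class a"
      using hom_mult[OF polar_class_hom[where 'a=circle_ring], of x "to_fract b"] \<open>x \<noteq> 0\<close> x
      by (simp add: polar_class_def X mult_group_def)
    then have "X = polar_class a \<otimes>\<^bsub>circle_polar\<^esub> inv\<^bsub>circle_polar\<^esub> (polar_class b)"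
      using P.inv_solve_right \<open>X \<in> carrier circle_polar\<close> polar_class_in_carrier x by metis
    then show "X \<in> M"
      using B x subgroup.m_closed[OF M] subgroup.m_inv_closed[OF M] by simp
  qed
qed

theorem mainTheorem5:
  fixes V U :: "complex set"
    and P :: "circle_ring cplx fract set monoid"
    and cls :: "complex \<Rightarrow> circle_ring cplx fract set"
    and G H :: "circle_ring cplx fract set set"
  assumes V: "V = {z. norm z = 1}"
    and U: "U = {z. 0 < norm z \<and> norm z < 1}"
    and P: "P = polar_group TYPE(circle_ring)"
    and cls: "\<And>z. cls z = polar_class (circle_t - circle_cconst z)"
    and G: "G = generate P (cls ` V)"
    and H: "H = generate P (cls ` U)"
  shows "(\<forall>\<gamma>\<in>G. \<gamma> [^]\<^bsub>P\<^esub> (2::nat) = \<one>\<^bsub>P\<^esub>) \<and>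
         G = generate P {cls (exp (\<i> * of_real \<theta>)) | \<theta>. 0 \<le> \<theta> \<and> \<theta> < pi / 2} \<and>
         (\<exists>\<phi> \<in> iso (free_Abelian_group U) (P\<lparr>carrier := H\<rparr>). \<forall>z\<in>U. \<phi> (frag_of z) = cls z) \<and>
         internal_direct_product P G H"
proof -
  interpret P: comm_group P unfolding P by (rule comm_group_polar_group)
  have carr: "cls z \<in> carrier P" for z
    unfolding P cls by (rule circle_class_carrier)
  have sub: "subgroup G P" "subgroup H P"
    unfolding G H using carr by (auto intro!: P.generate_is_subgroup)

  \<comment> \<open>The group generated by the classes of the unit circle\<close>
  have on_V: "cls z = cls 1" if "z \<in> V" for z
    using that circle_class_unit_circle unfolding V cls by simp
  have "1 \<in> V" by (simp add: V)
  then have "cls ` V = {cls 1}" using on_V by blast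
  moreover have "{cls (exp (\<i> * of_real \<theta>)) | \<theta>. 0 \<le> \<theta> \<and> \<theta> < pi / 2} = {cls 1}"
  proof -
    have "cls (exp (\<i> * of_real \<theta>)) = cls 1" for \<theta> by (intro on_V) (simp add: V)
    \<comment> \<open>The angle 0 shows that the set of classes is not empty.\<close>
    moreover have "0 \<le> (0::real) \<and> 0 < pi / 2" by simp
    ultimately show ?thesis by blast
  qed
  ultimately have G_angle: "G = generate P {cls (exp (\<i> * of_real \<theta>)) | \<theta>. 0 \<le> \<theta> \<and> \<theta> < pi / 2}"
    and G1: "G = generate P {cls 1}"
    unfolding G by simp_all
  have sq1: "cls 1 \<otimes>\<^bsub>P\<^esub> cls 1 = \<one>\<^bsub>P\<^esub>"
    unfolding P cls by (rule circle_class_mult_unit_circle) simp_all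
  then have inv1: "inv\<^bsub>P\<^esub> cls 1 = cls 1" using carr by (metis P.inv_equality)
  have G_sq: "\<gamma> \<otimes>\<^bsub>P\<^esub> \<gamma> = \<one>\<^bsub>P\<^esub>" if "\<gamma> \<in> G" for \<gamma>
  proof -
    \<comment> \<open>As \<open>cls 1\<close> is its own inverse, the identity and
      \<open>cls 1\<close> already form a set closed under products and inverses.\<close>
    have "\<gamma> = \<one>\<^bsub>P\<^esub> \<or> \<gamma> = cls 1"
      using that unfolding G1
    proof (induction rule: generate.induct)
      case (eng a b)
      then show ?case using sq1 carr P.l_one P.r_one P.one_closed by metis
    qed (simp_all only: singleton_iff inv1 simp_thms)
    then show ?thesis using sq1 P.l_one P.one_closed by metis
  qed

  \<comment> \<open>Freeness of \<open>H\<close>\<close>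
  have H_carr: "h \<in> carrier P" if "h \<in> H" for h
    using that subgroup.subset[OF sub(2)] by blast
  have cls_H: "cls z \<in> H" if "z \<in> U" for z
    unfolding H using that by (auto intro: generate.incl)

  interpret HP: comm_group "P\<lparr>carrier := H\<rparr>"
    by (rule group.group_comm_groupI[OF P.subgroup_imp_group[OF sub(2)]])
      (simp add: P.m_comm H_carr)
  obtain \<phi> where \<phi>: "\<phi> \<in> hom (free_Abelian_group U) (P\<lparr>carrier := H\<rparr>)"
      and \<phi>_of: "\<And>z. z \<in> U \<Longrightarrow> \<phi> (frag_of z) = cls z"
    using HP.free_Abelian_group_universal[of cls U] cls_H by auto
  interpret F: group "free_Abelian_group U" by simp
  interpret \<phi>: group_hom "free_Abelian_group U" "P\<lparr>carrier := H\<rparr>" \<phi>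
    using \<phi> by unfold_locales
  have \<phi>P: "\<phi> \<in> hom (free_Abelian_group U) P"
    using \<phi> H_carr by (auto simp: hom_def)
  \<comment> \<open>Composing \<open>\<phi>\<close> with the coefficient homomorphism at
    \<open>z\<close> gives a map that agrees with \<open>lookup\<close> at \<open>z\<close> on the
    basis, hence on every formal sum supported in \<open>U\<close>.\<close>
  have coeff: "\<exists>\<psi> \<in> hom P integer_group. \<forall>c \<in> carrier (free_Abelian_group U).
      \<psi> (\<phi> c) = Poly_Mapping.lookup c z" if "z \<in> U" for z
  proof -
    note z = that
    obtain \<psi> where \<psi>: "\<psi> \<in> hom P integer_group"
      and \<psi>_of: "\<And>w. w \<in> U \<Longrightarrow> \<psi> (cls w) = (if z = w then 1 else 0)"
    proof -
      have z: "0 < norm z" "norm z < 1" using z by (simp_all add: U)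
      show ?thesis
        by (rule circle_polar_coefficient[OF z], rule that) (auto simp: P cls U)
    qed
    have hom: "\<psi> \<circ> \<phi> \<in> hom (free_Abelian_group U) integer_group"
      using hom_compose[OF \<phi>P \<psi>] .
    interpret \<psi>\<phi>: group_hom "free_Abelian_group U" integer_group "\<psi> \<circ> \<phi>"
      by (intro group_hom.intro group_hom_axioms.intro hom) simp_all
    have "\<psi> (\<phi> c) = Poly_Mapping.lookup c z" if "Poly_Mapping.keys c \<subseteq> U" for c
      using that
    proof (rule free_Abelian_group_induct)
      show "\<psi> (\<phi> 0) = Poly_Mapping.lookup 0 z"
        using \<psi>\<phi>.hom_one by simp
    next
      fix w assume "w \<in> U"
      then show "\<psi> (\<phi> (frag_of w)) = Poly_Mapping.lookup (frag_of w) z"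
        by (simp add: \<phi>_of \<psi>_of)
    next
      fix a b :: "complex \<Rightarrow>\<^sub>0 int"
      assume ab: "Poly_Mapping.keys a \<subseteq> U" "Poly_Mapping.keys b \<subseteq> U"
        and IH: "\<psi> (\<phi> a) = Poly_Mapping.lookup a z" "\<psi> (\<phi> b) = Poly_Mapping.lookup b z"
      then show "\<psi> (\<phi> (a - b)) = Poly_Mapping.lookup (a - b) z"
        using \<psi>\<phi>.hom_mult[of a "- b"] \<psi>\<phi>.hom_inv[of b] by (simp add: lookup_minus)
    qed
    then show ?thesis by (intro bexI[OF _ \<psi>]) simp
  qed
  \<comment> \<open>Coefficients at points of \<open>U\<close> are recovered from the image by
    \<open>coeff\<close>; those elsewhere are 0 by the support condition.\<close>
  have inj: "c = d" if "Poly_Mapping.keys c \<subseteq> U" "Poly_Mapping.keys d \<subseteq> U" "\<phi> c = \<phi> d" for c d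
  proof (rule poly_mapping_eqI)
    fix z
    show "Poly_Mapping.lookup c z = Poly_Mapping.lookup d z"
    proof (cases "z \<in> U")
      case True
      then show ?thesis using coeff[OF True] that by (metis carrier_free_Abelian_group_iff)
    next
      case False
      then show ?thesis using that by (metis in_keys_iff subsetD)
    qed
  qed
  \<comment> \<open>The image is a subgroup containing all generators of \<open>H\<close>.\<close>
  have "H \<subseteq> \<phi> ` carrier (free_Abelian_group U)"
    unfolding H
  proof (rule P.generate_subgroup_incl)
    show "cls ` U \<subseteq> \<phi> ` carrier (free_Abelian_group U)"
      by (auto simp: simp flip: \<phi>_of)
    show "subgroup (\<phi> ` carrier (free_Abelian_group U)) P"
      using \<phi>.img_is_subgroup P.incl_subgroup[OF sub(2)] by blast
  qed
  then have surj: "\<phi> ` carrier (free_Abelian_group U) = H"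
    using \<phi>.hom_closed by auto
  have "\<phi> \<in> iso (free_Abelian_group U) (P\<lparr>carrier := H\<rparr>)"
    using \<phi> inj surj by (auto simp: iso_def bij_betw_def inj_on_def)
  then have H_free: "\<exists>\<phi> \<in> iso (free_Abelian_group U) (P\<lparr>carrier := H\<rparr>). \<forall>z\<in>U. \<phi> (frag_of z) = cls z"
    using \<phi>_of by blast

  \<comment> \<open>Trivial intersection of \<open>G\<close> and \<open>H\<close>\<close>
  have "g = \<one>\<^bsub>P\<^esub>" if g: "g \<in> G" "g \<in> H" for g
  proof -
    obtain c where c: "Poly_Mapping.keys c \<subseteq> U" "g = \<phi> c"
      using g(2) surj by auto
    have "c = 0"
    proof (rule poly_mapping_eqI)
      fix z
      show "Poly_Mapping.lookup c z = Poly_Mapping.lookup 0 z"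
      proof (cases "z \<in> U")
        case True
        then obtain \<psi> where \<psi>: "\<psi> \<in> hom P integer_group" "\<psi> g = Poly_Mapping.lookup c z"
          using coeff c by (metis carrier_free_Abelian_group_iff)
        \<comment> \<open>Since \<open>g\<close> squares to the identity, twice its coefficient is
          0, and the integers have no torsion.\<close>
        have "\<psi> g + \<psi> g = \<psi> (g \<otimes>\<^bsub>P\<^esub> g)"
          using hom_mult[OF \<psi>(1) H_carr[OF g(2)] H_carr[OF g(2)]] by simp
        also have "\<dots> = 0"
          using hom_one[OF \<psi>(1) P.group_axioms group_integer_group] by (simp add: G_sq[OF g(1)])
        finally show ?thesis using \<psi>(2) by simp
      next
        case False
        then show ?thesis using c by (metis in_keys_iff lookup_zero subsetD)
      qed
    qed
    then show ?thesis using c(2) \<phi>.hom_one by simp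
  qed
  then have int: "G \<inter> H = {\<one>\<^bsub>P\<^esub>}"
    using subgroup.one_closed[OF sub(1)] subgroup.one_closed[OF sub(2)] by blast

  \<comment> \<open>The product of \<open>G\<close> and \<open>H\<close> is the whole group\<close>
  have "G <#>\<^bsub>P\<^esub> H = carrier P"
    unfolding P
  proof (rule circle_polar_generated)
    show "subgroup (G <#>\<^bsub>polar_group TYPE(circle_ring)\<^esub> H) circle_polar"
      using P.mult_subgroups[OF sub] unfolding P .
    have GH: "g \<in> G \<Longrightarrow> g \<in> G <#>\<^bsub>P\<^esub> H" "h \<in> H \<Longrightarrow> h \<in> G <#>\<^bsub>P\<^esub> H" for g h
    proof -
      show "g \<in> G <#>\<^bsub>P\<^esub> H" if "g \<in> G"
        using that subgroup.one_closed[OF sub(2)] subgroup.mem_carrier[OF sub(1)]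
        unfolding set_mult_def by force
      show "h \<in> G <#>\<^bsub>P\<^esub> H" if "h \<in> H"
        using that subgroup.one_closed[OF sub(1)] subgroup.mem_carrier[OF sub(2)]
        unfolding set_mult_def by force
    qed
    fix z :: complex assume z: "z \<noteq> 0"
    consider "z \<in> V" | "z \<in> U" | "norm z > 1"
      using z unfolding V U by fastforce
    then have "cls z \<in> G <#>\<^bsub>P\<^esub> H"
    proof cases
      case 1
      then show ?thesis by (intro GH(1)) (auto simp: G intro: generate.incl)
    next
      case 2
      then show ?thesis by (intro GH(2) cls_H)
    next
      case 3
      \<comment> \<open>For a point outside the closed disc, the mirror point lies in
        \<open>U\<close>, and its class is the inverse of \<open>cls z\<close>; so
        \<open>cls z\<close> lies in \<open>H\<close>.\<close>
      then have w: "1 / cnj z \<in> U" using z by (simp add: U norm_divide)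
      have "cls z \<otimes>\<^bsub>P\<^esub> cls (1 / cnj z) = \<one>\<^bsub>P\<^esub>"
        unfolding P cls by (rule circle_class_mult_reflection[OF z])
      then have "cls z = inv\<^bsub>P\<^esub> cls (1 / cnj z)" using carr by (metis P.inv_equality)
      then show ?thesis
        using GH(2) cls_H[OF w] subgroup.m_inv_closed[OF sub(2)] by metis
    qed
    then show "circle_class z \<in> G <#>\<^bsub>polar_group TYPE(circle_ring)\<^esub> H"
      unfolding P cls .
  qed
  then have "internal_direct_product P G H"
    unfolding internal_direct_product_def
    using int sub by (simp add: P.subgroup_imp_normal)
  with H_free G_angle show ?thesis
    using G_sq subgroup.mem_carrier[OF sub(1)] by (simp add: numeral_2_eq_2)
qed

end
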